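(* Let $m\geqslant2$ be an integer. For a binary sequence $d$ let $Z^{(d)}_{\ast,1}(\beta)$ be the first affine component of the limit point with symbolic address $d$ for the de Casteljau IFS of a Bézier curve of degree $m$ with parameter $t=\tfrac12+\mathrm{i}\beta$, as defined in the context, and let $\pi_m(d)=m\sum_{k\geqslant1}d_k2^{-k}\in[0,m]$. Then for every $x\in[0,m]$ $$\left.\frac{\mathrm{d}Z_{\ast,1}^{(\pi_m^{-1}(x))}(\beta)}{\mathrm{d}\beta}\right|_{\beta=0}=2m\,\mathrm{i}\,\mathrm{T}(x/m),$$ where $\mathrm{T}$ is the Takagi function.
   Context: **Takagi function.** $\mathrm{T}(x)=\sum_{n=0}^{\infty}\sigma(2^nx)/2^n$ for $x\in[0,1]$, where $\sigma(x)=\min_{n\in\mathbb{Z}}|x-n|$. **Binary sequences.** $\Omega$ is the set of infinite binary sequences $d=(d_1,d_2,\ldots)\in\{0,1\}^{\mathbb{N}}$ that are not eventually all ones, together with the sequence $(1,1,1,\ldots)$. Then $\pi_m:\Omega\to[0,m]$ is a bijection. **The matrices.** For real $\beta$ put $t=\tfrac12+\mathrm{i}\beta$. Consider the $(m+1)\times(m+1)$ lower-triangular de Casteljau matrices, with indices $i,j=0,\ldots,m$, $$\mathbf{M}^{(0)}_{i,j}=\delta_{i,j}t^i,\qquad \mathbf{M}^{(1)}_{i,j}=\binom{m-j}{m-i}t^{i-j}(1-t)^j$$ (entries with $i<j$ being $0$), acting on column vectors $(1,z_1,\ldots,z_m)^\top$ of homogeneous coordinates in $\mathbb{C}^m$.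 For $d\in\Omega$ and $n\geqslant 0$ define $$(1,Z_{n,1}^{(d)},\ldots,Z_{n,m}^{(d)})^\top=\mathbf{M}^{(d_1)}\mathbf{M}^{(d_2)}\cdots\mathbf{M}^{(d_n)}\,(1,0,\ldots,0)^\top ,$$ whose entries are polynomials in $\mathrm{i}\beta$ with coefficients in $\mathbb{Z}[1/2]$. $Z_{\ast,1}^{(d)}(\beta)$ denotes the coefficientwise limit of $Z_{n,1}^{(d)}(\beta)$ as $n\to\infty$, which exists and is a power series in $\beta$ convergent for $|\beta|<\tfrac12$. *)

theory Defs
  imports "HOL-Analysis.FPS_Convergence" "Jordan_Normal_Form.Matrix"
begin

(* The minimum of \<bar>x - n\<bar> over all integers n is attained, so it equals the infimum. *)
definition dist_int :: "real \<Rightarrow> real" where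
  "dist_int x = (INF n::int. \<bar>x - of_int n\<bar>)"

definition takagi :: "real \<Rightarrow> real" where
  "takagi x = (\<Sum>n. dist_int (2 ^ n * x) / 2 ^ n)"

(* Sequences are indexed from 0: d k is the digit usually written d_{k+1}. *)
definition Omega :: "(nat \<Rightarrow> nat) set" where
  "Omega = {d. (\<forall>k. d k \<in> {0, 1}) \<and> \<not> (\<exists>N. \<forall>k\<ge>N. d k = 1)} \<union> {\<lambda>k. 1}"

definition address_val :: "nat \<Rightarrow> (nat \<Rightarrow> nat) \<Rightarrow> real" where
  "address_val m d = real m * (\<Sum>k. real (d k) / 2 ^ (k + 1))"

(* The parameter t ranges over an arbitrary commutative ring, so that it can be a complex
   number as well as a polynomial. *)
definition casteljau0 :: "nat \<Rightarrow> 'a::comm_ring_1 \<Rightarrow> 'a mat" where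
  "casteljau0 m t = mat (m + 1) (m + 1) (\<lambda>(i, j). if i = j then t ^ i else 0)"

definition casteljau1 :: "nat \<Rightarrow> 'a::comm_ring_1 \<Rightarrow> 'a mat" where
  "casteljau1 m t = mat (m + 1) (m + 1)
     (\<lambda>(i, j). if i < j then 0
               else of_nat ((m - j) choose (m - i)) * t ^ (i - j) * (1 - t) ^ j)"

definition casteljau :: "nat \<Rightarrow> nat \<Rightarrow> 'a::comm_ring_1 \<Rightarrow> 'a mat" where
  "casteljau m b t = (if b = 0 then casteljau0 m t else casteljau1 m t)"

definition casteljau_vec :: "nat \<Rightarrow> 'a::comm_ring_1 \<Rightarrow> (nat \<Rightarrow> nat) \<Rightarrow> nat \<Rightarrow> 'a vec" where
  "casteljau_vec m t d n =
     foldr (\<lambda>k A. casteljau m (d k) t * A) [0..<n] (1\<^sub>m (m + 1)) *\<^sub>v unit_vec (m + 1) 0"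

(* t = 1/2 + i * beta as a polynomial in the indeterminate beta. *)
definition t_poly :: "complex poly" where
  "t_poly = [:1 / 2, \<i>:]"

definition Z_poly :: "nat \<Rightarrow> (nat \<Rightarrow> nat) \<Rightarrow> nat \<Rightarrow> nat \<Rightarrow> complex poly" where
  "Z_poly m d n j = vec_index (casteljau_vec m t_poly d n) j"

definition Z_lim :: "nat \<Rightarrow> (nat \<Rightarrow> nat) \<Rightarrow> nat \<Rightarrow> complex fps" where
  "Z_lim m d j = Abs_fps (\<lambda>k. lim (\<lambda>n. coeff (Z_poly m d n j) k))"

end

theory Submission
  imports Defs
begin

unbundle no vec_syntax

text \<open>
  The matrices are lower triangular, so the first affine component evolves on its own: prepending
  the digit \<open>0\<close> acts by \<open>z \<mapsto> t z\<close>, prepending \<open>1\<close> acts by \<open>z \<mapsto> m t + (1 - t) z\<close>.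
  Both maps have linear part \<open>1/2 \<plusminus> i \<beta>\<close>, and multiplication by it contracts the norm
  \<open>sup\<^sub>k |c\<^sub>k| / 4^k\<close> of coefficient sequences by \<open>3/4\<close>; hence the limit exists and converges near \<open>0\<close>. Its coefficients of
  order \<open>0\<close> and \<open>1\<close> satisfy the recursions of \<open>m y\<close> and of \<open>2 m i T(y)\<close>, where
  \<open>y = 0.d\<^sub>1d\<^sub>2\<dots>\<close> in base two and \<open>T(y) = \<sigma>(y) + T(2 y) / 2\<close>; bounded solutions of these
  recursions are unique because of the factor \<open>1/2\<close>.
\<close>

section \<open>The Takagi function\<close>

text \<open>Any other integer is at distance at least 1 from \<open>k\<close>, hence at least 1/2
  from \<open>x\<close>. This turns the infimum into an explicit distance, used with
  \<open>k\<close> equal to 0, 1 or \<open>round x\<close>.\<close>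

lemma dist_int_eq:
  assumes "\<bar>x - of_int k\<bar> \<le> 1 / 2"
  shows "dist_int x = \<bar>x - of_int k\<bar>"
  unfolding dist_int_def
proof (rule cInf_eq_minimum)
  fix z assume "z \<in> range (\<lambda>n. \<bar>x - of_int n\<bar>)"
  then obtain n where z: "z = \<bar>x - of_int n\<bar>" by blast
  show "\<bar>x - of_int k\<bar> \<le> z"
  proof (cases "n = k")
    case False
    then have "\<bar>k - n\<bar> \<ge> 1" by linarith
    then have "\<bar>real_of_int k - of_int n\<bar> \<ge> 1" by linarith
    with assms z show ?thesis by linarith
  qed (simp add: z)
qed auto

lemma dist_int_round: "dist_int x = \<bar>x - of_int (round x)\<bar>"
  using of_int_round_abs_le[of x] by (intro dist_int_eq) linarith

lemma dist_int_bounds: "0 \<le> dist_int x" "dist_int x \<le> 1 / 2"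
  using of_int_round_abs_le[of x] unfolding dist_int_round by linarith+

lemma dist_int_add_of_int: "dist_int (x + of_int k) = dist_int x"
proof -
  have "\<bar>x + of_int k - of_int (round x + k)\<bar> \<le> 1 / 2"
    using of_int_round_abs_le[of x] by (simp add: abs_minus_commute)
  then show ?thesis
    using dist_int_eq[of "x + of_int k" "round x + k"] by (simp add: dist_int_round)
qed

lemma takagi_summable: "summable (\<lambda>n. dist_int (2 ^ n * x) / 2 ^ n)"
proof (rule summable_comparison_test')
  show "summable (\<lambda>n. (1 / 2) ^ n :: real)"
    by (rule summable_geometric) simp
  show "norm (dist_int (2 ^ n * x) / 2 ^ n) \<le> (1 / 2) ^ n" if "n \<ge> 0" for n
    using dist_int_bounds[of "2 ^ n * x"] by (simp add: power_divide divide_right_mono)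
qed

text \<open>A crude bound by a geometric series; what matters is that it is uniform in
  \<open>x\<close>, so that the uniqueness argument for bounded solutions applies.\<close>

lemma takagi_bound: "\<bar>takagi x\<bar> \<le> 2"
proof -
  have "0 \<le> takagi x"
    unfolding takagi_def using takagi_summable dist_int_bounds
    by (intro suminf_nonneg) auto
  moreover have "takagi x \<le> (\<Sum>n. (1 / 2) ^ n)"
    unfolding takagi_def
  proof (rule suminf_le[OF _ takagi_summable])
    show "dist_int (2 ^ n * x) / 2 ^ n \<le> (1 / 2) ^ n" for n
      using dist_int_bounds[of "2 ^ n * x"] by (simp add: power_divide divide_right_mono)
  qed (simp add: summable_geometric)
  ultimately show ?thesis by (simp add: suminf_geometric)
qed

lemma takagi_double: "takagi x = dist_int x + takagi (2 * x) / 2"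
proof -
  have "(\<Sum>n. dist_int (2 ^ Suc n * x) / 2 ^ Suc n) = takagi (2 * x) / 2"
    unfolding takagi_def
    by (subst suminf_divide[OF takagi_summable, symmetric]) (simp add: mult_ac)
  then show ?thesis
    using suminf_split_head[OF takagi_summable, of x] by (simp add: takagi_def)
qed

text \<open>Each \<open>2 ^ n * k\<close> is an integer, so every term of the series is
  unchanged.\<close>

lemma takagi_add_of_nat: "takagi (x + of_nat k) = takagi x"
proof -
  have "dist_int (2 ^ n * (x + of_nat k)) = dist_int (2 ^ n * x)" for n
    using dist_int_add_of_int[of "2 ^ n * x" "2 ^ n * int k"] by (simp add: algebra_simps)
  then show ?thesis by (simp add: takagi_def)
qed

section \<open>Binary expansions\<close>

definition binary_seq :: "(nat \<Rightarrow> nat) \<Rightarrow> bool" where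
  "binary_seq d \<longleftrightarrow> (\<forall>k. d k \<in> {0, 1})"

definition binary_val :: "(nat \<Rightarrow> nat) \<Rightarrow> real" where
  "binary_val d = (\<Sum>k. real (d k) / 2 ^ (k + 1))"

abbreviation (input) shift :: "(nat \<Rightarrow> nat) \<Rightarrow> nat \<Rightarrow> nat" where
  "shift d \<equiv> \<lambda>k. d (Suc k)"

lemma binary_seq_shift: "binary_seq d \<Longrightarrow> binary_seq (shift d)"
  by (simp add: binary_seq_def)

lemma half_powers_sums: "(\<lambda>k. 1 / 2 ^ (k + 1) :: real) sums 1"
  using power_half_series by (simp add: power_divide)

lemma binary_digit_le:
  assumes "binary_seq d"
  shows "real (d k) / 2 ^ (k + 1) \<le> 1 / 2 ^ (k + 1)"
  using assms[unfolded binary_seq_def, rule_format, of k] by auto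

lemma binary_summable:
  assumes "binary_seq d"
  shows "summable (\<lambda>k. real (d k) / 2 ^ (k + 1))"
  using binary_digit_le[OF assms]
  by (intro summable_comparison_test'[OF sums_summable[OF half_powers_sums]]) auto

lemma binary_val_bounds:
  assumes "binary_seq d"
  shows "0 \<le> binary_val d" "binary_val d \<le> 1"
proof -
  show "0 \<le> binary_val d"
    unfolding binary_val_def using binary_summable[OF assms] by (intro suminf_nonneg) auto
  show "binary_val d \<le> 1"
    unfolding binary_val_def
    using binary_digit_le[OF assms] summable_sums[OF binary_summable[OF assms]] half_powers_sums
    by (rule sums_le)
qed

lemma binary_val_shift:
  assumes "binary_seq d"
  shows "binary_val d = (real (d 0) + binary_val (shift d)) / 2"
proof -
  have "(\<Sum>k. real (d (Suc k)) / 2 ^ (Suc k + 1)) = binary_val (shift d) / 2"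
    unfolding binary_val_def
    by (subst suminf_divide[OF binary_summable[OF binary_seq_shift[OF assms]], symmetric])
       (simp add: mult_ac)
  then show ?thesis
    using suminf_split_head[OF binary_summable[OF assms]]
    by (simp add: binary_val_def add_divide_distrib)
qed

text \<open>The first digit decides in which half of [0,1] the value lies, hence whether 0 or 1 is a
  nearest integer. At 1/2 both are, and the two formulas agree.\<close>

lemma dist_int_binary_val:
  assumes "binary_seq d"
  shows "dist_int (binary_val d) =
    (if d 0 = 0 then binary_val (shift d) / 2 else (1 - binary_val (shift d)) / 2)"
proof (cases "d 0 = 0")
  case True
  then have "binary_val d = binary_val (shift d) / 2"
    using binary_val_shift[OF assms] by simp
  then show ?thesis
    using True dist_int_eq[of "binary_val d" 0] binary_val_bounds[OF binary_seq_shift[OF assms]]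
    by simp
next
  case False
  then have "d 0 = 1"
    using assms[unfolded binary_seq_def, rule_format, of 0] by simp
  moreover from this have "binary_val d = (1 + binary_val (shift d)) / 2"
    using binary_val_shift[OF assms] by simp
  ultimately show ?thesis
    using dist_int_eq[of "binary_val d" 1] binary_val_bounds[OF binary_seq_shift[OF assms]]
    by (simp add: abs_le_iff abs_if field_simps)
qed

text \<open>Doubling moves the first digit in front of the binary point, where the period 1 of
  \<open>takagi\<close> removes it.\<close>

lemma takagi_binary_val:
  assumes "binary_seq d"
  shows "takagi (binary_val d) = dist_int (binary_val d) + takagi (binary_val (shift d)) / 2"
proof -
  have "2 * binary_val d = binary_val (shift d) + of_nat (d 0)"
    using binary_val_shift[OF assms] by simp
  then have "takagi (2 * binary_val d) = takagi (binary_val (shift d))"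
    by (simp only: takagi_add_of_nat)
  then show ?thesis
    using takagi_double[of "binary_val d"] by simp
qed

lemma Omega_binary_seq: "d \<in> Omega \<Longrightarrow> binary_seq d"
  by (auto simp: Omega_def binary_seq_def)

text \<open>The digits are the increments \<open>f (Suc n) - 2 * f n\<close> of the floors of
  \<open>2 ^ n * y\<close>. Rounding down selects the terminating expansion of a dyadic number,
  which excludes a tail of ones.\<close>

lemma exists_binary_expansion:
  assumes "0 \<le> y" "y < 1"
  shows "\<exists>d\<in>Omega. binary_val d = y"
proof -
  define f where "f n = \<lfloor>2 ^ n * y\<rfloor>" for n :: nat
  define d where "d n = nat (f (Suc n) - 2 * f n)" for n
  have f: "real_of_int (f n) \<le> 2 ^ n * y" "2 ^ n * y < of_int (f n) + 1" for n
    unfolding f_def by linarith+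
  have step: "f (Suc n) - 2 * f n \<in> {0, 1}" for n
  proof -
    have "real_of_int (f (Suc n)) < of_int (2 * f n) + 2"
      "of_int (2 * f n) < real_of_int (f (Suc n)) + 1"
      using f[of n] f[of "Suc n"] by simp_all
    then have "f (Suc n) < 2 * f n + 2" "2 * f n < f (Suc n) + 1" by linarith+
    then show ?thesis by auto
  qed
  then have bin: "d n \<in> {0, 1}" for n
    unfolding d_def using step[of n] by (elim insertE) auto
  have d_f: "real (d n) = of_int (f (Suc n)) - 2 * of_int (f n)" for n
    unfolding d_def using step[of n] by auto
  have f0: "f 0 = 0"
    unfolding f_def using assms by (simp add: floor_eq_iff)
  \<comment> \<open>The partial sums telescope from \<open>f 0 = 0\<close> to the truncation of
    \<open>y\<close> to \<open>n\<close> binary places, which is within \<open>(1 / 2) ^ n\<close>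
    of \<open>y\<close>.\<close>
  have partial: "(\<Sum>k<n. real (d k) / 2 ^ (k + 1)) = of_int (f n) / 2 ^ n" for n
    by (induction n) (simp_all add: f0 d_f field_simps)
  have "(\<lambda>n. real_of_int (f n) / 2 ^ n) \<longlonglongrightarrow> y"
  proof (rule tendsto_sandwich[of "\<lambda>n. y - (1 / 2) ^ n" _ _ "\<lambda>_. y"])
    have "(\<lambda>n. (1 / 2) ^ n :: real) \<longlonglongrightarrow> 0"
      by (rule LIMSEQ_power_zero) simp
    from tendsto_diff[OF tendsto_const[of y] this]
    show "(\<lambda>n. y - (1 / 2) ^ n) \<longlonglongrightarrow> y" by simp
    show "\<forall>\<^sub>F n in sequentially. y - (1 / 2) ^ n \<le> real_of_int (f n) / 2 ^ n"
    proof (intro always_eventually allI)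
      fix n
      have "y - (1 / 2) ^ n = (2 ^ n * y - 1) / 2 ^ n"
        by (simp add: power_divide diff_divide_distrib)
      also have "\<dots> \<le> real_of_int (f n) / 2 ^ n"
        using f(2)[of n] by (intro divide_right_mono) auto
      finally show "y - (1 / 2) ^ n \<le> real_of_int (f n) / 2 ^ n" .
    qed
    show "\<forall>\<^sub>F n in sequentially. real_of_int (f n) / 2 ^ n \<le> y"
      using f(1) by (intro always_eventually allI) (simp add: field_simps)
  qed simp
  then have "(\<lambda>k. real (d k) / 2 ^ (k + 1)) sums y"
    unfolding sums_def partial .
  then have val: "binary_val d = y"
    by (simp add: binary_val_def sums_iff)
  have "\<not> (\<exists>N. \<forall>k\<ge>N. d k = 1)"
  proof
    assume "\<exists>N. \<forall>k\<ge>N. d k = 1"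
    then obtain N where N: "\<And>k. k \<ge> N \<Longrightarrow> d k = 1" by blast
    \<comment> \<open>The distance from the tail value to \<open>1\<close> would double at each step.\<close>
    define g where "g n = of_int (f n) + 1 - 2 ^ n * y" for n
    have g_step: "g (Suc n) = 2 * g n" if "n \<ge> N" for n
      using d_f[of n] N[OF that] by (simp add: g_def algebra_simps)
    have grow: "g (N + k) = 2 ^ k * g N" for k
      by (induction k) (simp_all add: g_step)
    have "g N > 0"
      using f(2)[of N] by (simp add: g_def)
    then obtain k where "1 / g N < 2 ^ k"
      using real_arch_pow[of 2] by auto
    with \<open>g N > 0\<close> have "1 < g (N + k)"
      by (simp add: grow field_simps)
    moreover have "g (N + k) \<le> 1"
      using f(1)[of "N + k"] by (simp add: g_def)
    ultimately show False by simp
  qed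
  with bin have "d \<in> Omega"
    by (auto simp: Omega_def)
  with val show ?thesis by blast
qed

text \<open>Guarantees that \<open>inv_into\<close> yields a true address of \<open>x\<close>. The
  right endpoint has the all-ones address; all other points scale into [0,1).\<close>

lemma address_val_surj:
  assumes "m > 0" "x \<in> {0..real m}"
  shows "x \<in> address_val m ` Omega"
proof (cases "x = real m")
  case True
  have "address_val m (\<lambda>k. 1) = real m"
    using sums_unique[OF half_powers_sums] by (simp add: address_val_def)
  then show ?thesis
    using True by (intro image_eqI[of _ _ "\<lambda>k. 1"]) (auto simp: Omega_def)
next
  case False
  with assms have "0 \<le> x / real m" "x / real m < 1" by auto
  then obtain d where "d \<in> Omega" "binary_val d = x / real m"
    using exists_binary_expansion by blast
  then show ?thesis
    using assms by (intro image_eqI[of _ _ d]) (auto simp: address_val_def binary_val_def)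
qed

section \<open>The first affine component\<close>

lemma casteljau_carrier [simp]: "casteljau m b t \<in> carrier_mat (m + 1) (m + 1)"
  by (simp add: casteljau_def casteljau0_def casteljau1_def)

lemma casteljau_prod_carrier:
  "foldr (\<lambda>k A. casteljau m (d k) t * A) ks (1\<^sub>m (m + 1)) \<in> carrier_mat (m + 1) (m + 1)"
proof (induction ks)
  case (Cons k ks)
  from mult_carrier_mat[OF casteljau_carrier Cons.IH] show ?case by simp
qed simp

lemma casteljau_vec_carrier: "casteljau_vec m t d n \<in> carrier_vec (m + 1)"
  unfolding casteljau_vec_def
  using casteljau_prod_carrier by (rule mult_mat_vec_carrier) simp

lemma casteljau_vec_0: "casteljau_vec m t d 0 = unit_vec (m + 1) 0"
  by (simp add: casteljau_vec_def)

text \<open>The matrix of the first digit stands leftmost, so associativity peels it off. Recursions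
  thus run through the shifted sequence, not through the last digit.\<close>

lemma casteljau_vec_Suc:
  "casteljau_vec m t d (Suc n) = casteljau m (d 0) t *\<^sub>v casteljau_vec m t (shift d) n"
proof -
  have upt: "[0..<Suc n] = 0 # map Suc [0..<n]"
    by (simp add: map_Suc_upt upt_conv_Cons del: upt_Suc)
  show ?thesis
    unfolding casteljau_vec_def upt
    using assoc_mult_mat_vec[OF casteljau_carrier[of m "d 0" t]
        casteljau_prod_carrier[of m "shift d" t "[0..<n]"] unit_vec_carrier[of "m + 1" 0]]
    by (simp add: foldr_map comp_def)
qed

lemma casteljau_vec_index:
  assumes "i < m + 1"
  shows "casteljau_vec m t d (Suc n) $ i =
    (\<Sum>j<m + 1. casteljau m (d 0) t $$ (i, j) * casteljau_vec m t (shift d) n $ j)"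
  using assms casteljau_carrier[of m "d 0" t] casteljau_vec_carrier[of m t "shift d" n]
  by (simp add: casteljau_vec_Suc scalar_prod_def row_def lessThan_atLeast0
           carrier_matD carrier_vecD del: sum.op_ivl_Suc)

text \<open>Row 0 of either matrix is (1, 0, ..., 0), so the homogeneous coordinate is
  preserved.\<close>

lemma casteljau_vec_first: "casteljau_vec m t d n $ 0 = 1"
proof (induction n arbitrary: d)
  case 0
  then show ?case by (simp add: casteljau_vec_0)
next
  case (Suc n)
  have "casteljau m (d 0) t $$ (0, j) = (if j = 0 then 1 else 0)" if "j < m + 1" for j
    using that by (auto simp: casteljau_def casteljau0_def casteljau1_def)
  then have "(\<Sum>j<m + 1. casteljau m (d 0) t $$ (0, j) * casteljau_vec m t (shift d) n $ j) =
    (\<Sum>j<m + 1. if j = 0 then casteljau_vec m t (shift d) n $ j else 0)"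
    by (intro sum.cong) auto
  then have "casteljau_vec m t d (Suc n) $ 0 =
    (\<Sum>j<m + 1. if j = 0 then casteljau_vec m t (shift d) n $ j else 0)"
    by (simp only: casteljau_vec_index)
  then show ?case by (simp add: Suc.IH del: sum.lessThan_Suc)
qed

lemma casteljau_vec_second:
  assumes "m \<ge> 1"
  shows "casteljau_vec m t d (Suc n) $ 1 =
    (if d 0 = 0 then t * casteljau_vec m t (shift d) n $ 1
     else of_nat m * t + (1 - t) * casteljau_vec m t (shift d) n $ 1)"
proof -
  let ?a = "\<lambda>j. casteljau m (d 0) t $$ (1, j) * casteljau_vec m t (shift d) n $ j"
  have "casteljau_vec m t d (Suc n) $ 1 = (\<Sum>j<m + 1. ?a j)"
    using assms by (intro casteljau_vec_index) simp
  \<comment> \<open>Row 1 vanishes beyond column 1 by triangularity. For digit 1 its entry in column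
    0 is \<open>m choose (m - 1)\<close> times \<open>t\<close>, which gives the translation
    \<open>m * t\<close>.\<close>
  also have "\<dots> = (\<Sum>j\<in>{0, 1}. ?a j)"
    using assms by (intro sum.mono_neutral_right)
      (auto simp: casteljau_def casteljau0_def casteljau1_def)
  also have "\<dots> = (if d 0 = 0 then t * casteljau_vec m t (shift d) n $ 1
     else of_nat m * t + (1 - t) * casteljau_vec m t (shift d) n $ 1)"
    using assms choose_one[of m] binomial_symmetric[of 1 m]
    by (simp add: casteljau_vec_first casteljau_def casteljau0_def casteljau1_def)
  finally show ?thesis .
qed

lemma Z_poly_0: "m \<ge> 1 \<Longrightarrow> Z_poly m d 0 1 = 0"
  by (simp add: Z_poly_def casteljau_vec_0)

lemma Z_poly_Suc:
  assumes "m \<ge> 1"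
  shows "Z_poly m d (Suc n) 1 =
    (if d 0 = 0 then t_poly * Z_poly m (shift d) n 1
     else of_nat m * t_poly + (1 - t_poly) * Z_poly m (shift d) n 1)"
  unfolding Z_poly_def using casteljau_vec_second[OF assms] .

section \<open>Coefficientwise convergence of the iterates\<close>

lemma one_minus_t_poly: "1 - t_poly = [:1 / 2, - \<i>:]"
  by (simp add: t_poly_def one_pCons)

lemma coeff_linear_mult:
  "coeff ([:a, b:] * p) k = a * coeff p k + (case k of 0 \<Rightarrow> 0 | Suc l \<Rightarrow> b * coeff p l)"
  by (simp add: coeff_pCons split: nat.split)

text \<open>The factor is 3/4 = 1/2 + 1/4: with weight \<open>4 ^ k\<close>, raising the degree by
  one costs 1/4. Any weight base above 2 would also give a contraction.\<close>

lemma norm_coeff_linear_mult_le: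
  fixes p :: "complex poly"
  assumes p: "\<And>k. norm (coeff p k) \<le> C * 4 ^ k" and "norm b = 1"
  shows "norm (coeff ([:1 / 2, b:] * p) k) \<le> (3 / 4) * C * 4 ^ k"
proof (cases k)
  case 0
  have "0 \<le> C" using order_trans[OF norm_ge_zero p[of 0]] by simp
  then show ?thesis
    using p[of 0] 0 by (simp add: coeff_linear_mult norm_mult norm_divide)
next
  case (Suc l)
  have "norm (coeff ([:1 / 2, b:] * p) k) \<le> norm (1 / 2 * coeff p (Suc l)) + norm (b * coeff p l)"
    unfolding Suc coeff_linear_mult nat.case by (rule norm_triangle_ineq)
  also have "\<dots> \<le> (1 / 2) * (C * 4 ^ Suc l) + C * 4 ^ l"
    using p[of "Suc l"] p[of l] \<open>norm b = 1\<close> by (simp add: norm_mult norm_divide)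
  also have "\<dots> = (3 / 4) * C * 4 ^ k" using Suc by simp
  finally show ?thesis .
qed

text \<open>The translation \<open>m * t\<close> cancels in differences, so an increment is a linear
  factor times the previous increment along \<open>shift d\<close>; hence the induction with
  \<open>d\<close> arbitrary. The first increment is 0 or \<open>m * t\<close>.\<close>

lemma Z_poly_increment_bound:
  assumes "m \<ge> 1"
  shows "norm (coeff (Z_poly m d (Suc n) 1 - Z_poly m d n 1) k) \<le> real m * (3 / 4) ^ n * 4 ^ k"
proof (induction n arbitrary: d k)
  case 0
  have "norm (coeff (of_nat m * t_poly) k) \<le> real m * 4 ^ k"
  proof -
    have "norm (coeff t_poly k) \<le> 4 ^ k"
      by (auto simp: t_poly_def coeff_pCons norm_divide split: nat.split)
    then show ?thesis
      by (simp add: of_nat_poly norm_mult mult_left_mono)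
  qed
  then show ?case
    using assms by (simp add: Z_poly_Suc Z_poly_0 del: One_nat_def)
next
  case (Suc n)
  let ?q = "Z_poly m (shift d) (Suc n) 1 - Z_poly m (shift d) n 1"
  have "Z_poly m d (Suc (Suc n)) 1 - Z_poly m d (Suc n) 1 =
    (if d 0 = 0 then [:1 / 2, \<i>:] else [:1 / 2, - \<i>:]) * ?q"
    unfolding Z_poly_Suc[OF assms, of d] one_minus_t_poly
    by (cases "d 0 = 0"; simp only: t_poly_def if_True if_False simp_thms)
       (simp_all only: algebra_simps)
  moreover have "norm (coeff ([:1 / 2, b:] * ?q) k) \<le> (3 / 4) * (real m * (3 / 4) ^ n) * 4 ^ k"
    if "norm b = 1" for b
    using Suc.IH that by (rule norm_coeff_linear_mult_le)
  ultimately show ?case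
    by (cases "d 0 = 0") (simp_all only: if_True if_False simp_thms norm_ii norm_minus_cancel
      power_Suc mult_ac)
qed

text \<open>The increments telescope and are dominated by a geometric series of ratio 3/4, whose sum
  contributes the factor 4. The resulting bound is independent of \<open>d\<close>.\<close>

lemma Z_poly_coeff_limit:
  assumes "m \<ge> 1"
  shows "(\<lambda>n. coeff (Z_poly m d n 1) k) \<longlonglongrightarrow> fps_nth (Z_lim m d 1) k"
    and "norm (fps_nth (Z_lim m d 1) k) \<le> 4 * real m * 4 ^ k"
proof -
  let ?u = "\<lambda>n. coeff (Z_poly m d (Suc n) 1 - Z_poly m d n 1) k"
  have geo: "(\<lambda>n. real m * (3 / 4) ^ n * 4 ^ k) sums (real m * 4 * 4 ^ k)"
    using geometric_sums[of "3 / 4 :: real"] by (intro sums_mult sums_mult2) simp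
  have summ: "summable ?u"
    using Z_poly_increment_bound[OF assms]
    by (intro summable_comparison_test'[OF sums_summable[OF geo]]) auto
  have "(\<Sum>i<n. ?u i) = coeff (Z_poly m d n 1) k" for n
    using sum_lessThan_telescope[of "\<lambda>n. coeff (Z_poly m d n 1) k" n] Z_poly_0[OF assms, of d]
    by simp
  then have lim: "(\<lambda>n. coeff (Z_poly m d n 1) k) \<longlonglongrightarrow> suminf ?u"
    using summable_LIMSEQ[OF summ] by simp
  then have nth: "fps_nth (Z_lim m d 1) k = suminf ?u"
    by (simp add: Z_lim_def limI)
  show "(\<lambda>n. coeff (Z_poly m d n 1) k) \<longlonglongrightarrow> fps_nth (Z_lim m d 1) k"
    using lim nth by simp
  have "norm (suminf ?u) \<le> real m * 4 * 4 ^ k"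
    using norm_sums_le[OF summable_sums[OF summ] geo Z_poly_increment_bound[OF assms]] .
  then show "norm (fps_nth (Z_lim m d 1) k) \<le> 4 * real m * 4 ^ k"
    by (simp add: nth mult_ac del: One_nat_def)
qed

section \<open>Recursions for the coefficients of order 0 and 1\<close>

lemma Z_lim_nth_0_shift:
  assumes "m \<ge> 1"
  shows "fps_nth (Z_lim m d 1) 0 =
    (if d 0 = 0 then 0 else of_nat m / 2) + fps_nth (Z_lim m (shift d) 1) 0 / 2"
proof (rule LIMSEQ_unique)
  show "(\<lambda>n. coeff (Z_poly m d (Suc n) 1) 0) \<longlonglongrightarrow> fps_nth (Z_lim m d 1) 0"
    using Z_poly_coeff_limit(1)[OF assms] by (rule LIMSEQ_Suc)
  have "coeff (Z_poly m d (Suc n) 1) 0 =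
    (if d 0 = 0 then 0 else of_nat m / 2) + coeff (Z_poly m (shift d) n 1) 0 / 2" for n
    unfolding Z_poly_Suc[OF assms] one_minus_t_poly
    by (simp add: t_poly_def of_nat_poly coeff_linear_mult coeff_pCons)
  then show "(\<lambda>n. coeff (Z_poly m d (Suc n) 1) 0) \<longlonglongrightarrow>
    (if d 0 = 0 then 0 else of_nat m / 2) + fps_nth (Z_lim m (shift d) 1) 0 / 2"
    by (simp only:) (intro tendsto_intros Z_poly_coeff_limit(1)[OF assms], simp)
qed

text \<open>In order 1 the linear factor contributes half the old first coefficient and plus or
  minus i times the old constant one; for digit 1, \<open>m * t\<close> adds
  \<open>\<i> * m\<close>. The recursion then passes to the limit.\<close>

lemma Z_lim_nth_1_shift:
  assumes "m \<ge> 1"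
  shows "fps_nth (Z_lim m d 1) 1 =
    (if d 0 = 0 then \<i> * fps_nth (Z_lim m (shift d) 1) 0
     else \<i> * (of_nat m - fps_nth (Z_lim m (shift d) 1) 0)) + fps_nth (Z_lim m (shift d) 1) 1 / 2"
    (is "_ = ?R (fps_nth (Z_lim m (shift d) 1) 0) (fps_nth (Z_lim m (shift d) 1) 1)")
proof (rule LIMSEQ_unique)
  show "(\<lambda>n. coeff (Z_poly m d (Suc n) 1) 1) \<longlonglongrightarrow> fps_nth (Z_lim m d 1) 1"
    using Z_poly_coeff_limit(1)[OF assms] by (rule LIMSEQ_Suc)
  have "coeff (Z_poly m d (Suc n) 1) 1 =
    ?R (coeff (Z_poly m (shift d) n 1) 0) (coeff (Z_poly m (shift d) n 1) 1)" for n
    unfolding Z_poly_Suc[OF assms] one_minus_t_poly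
    by (simp add: t_poly_def of_nat_poly coeff_linear_mult coeff_pCons algebra_simps)
  then show "(\<lambda>n. coeff (Z_poly m d (Suc n) 1) 1) \<longlonglongrightarrow>
    ?R (fps_nth (Z_lim m (shift d) 1) 0) (fps_nth (Z_lim m (shift d) 1) 1)"
    using Z_poly_coeff_limit(1)[OF assms, of "shift d"]
    by (cases "d 0 = 0") (auto intro!: tendsto_intros simp del: One_nat_def)
qed

text \<open>Applied to the difference of two solutions of the same recursion. Iterating
  \<open>n\<close> times gives the bound \<open>C / 2 ^ n\<close>; since the argument moves to
  shifts, one \<open>C\<close> must serve all binary sequences.\<close>

lemma halving_bounded_eq_0:
  fixes D :: "(nat \<Rightarrow> nat) \<Rightarrow> complex"
  assumes step: "\<And>d. binary_seq d \<Longrightarrow> D d = D (shift d) / 2"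
    and bound: "\<And>d. binary_seq d \<Longrightarrow> norm (D d) \<le> C"
    and "binary_seq d"
  shows "D d = 0"
proof -
  have le: "norm (D d) \<le> C * (1 / 2) ^ n" if "binary_seq d" for n d
    using that
  proof (induction n arbitrary: d)
    case 0
    then show ?case using bound by simp
  next
    case (Suc n)
    then have "norm (D (shift d)) \<le> C * (1 / 2) ^ n"
      using binary_seq_shift by blast
    then show ?case
      by (simp add: step[OF Suc.prems] norm_divide)
  qed
  have "(\<lambda>n. C * (1 / 2) ^ n) \<longlonglongrightarrow> C * 0"
    by (intro tendsto_mult tendsto_const LIMSEQ_power_zero) simp
  then have "norm (D d) \<le> 0"
    using le[OF assms(3)] by (intro LIMSEQ_le_const[of _ "0 :: real"]) auto
  then show ?thesis by simp
qed

lemma Z_lim_nth_0: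
  assumes "m \<ge> 1" "binary_seq d"
  shows "fps_nth (Z_lim m d 1) 0 = of_nat m * of_real (binary_val d)"
proof -
  let ?D = "\<lambda>d. fps_nth (Z_lim m d 1) 0 - of_nat m * of_real (binary_val d)"
  have "?D d = 0"
  proof (rule halving_bounded_eq_0[OF _ _ assms(2), of ?D])
    fix e assume e: "binary_seq e"
    then have "e 0 = 0 \<or> e 0 = 1" by (auto simp: binary_seq_def)
    then show "?D e = ?D (shift e) / 2"
      unfolding Z_lim_nth_0_shift[OF assms(1), of e] binary_val_shift[OF e]
      by (auto simp: field_simps)
    have "norm (?D e) \<le> norm (fps_nth (Z_lim m e 1) 0) + norm (of_nat m * of_real (binary_val e) :: complex)"
      by (rule norm_triangle_ineq4)
    also have "\<dots> \<le> 4 * real m * 4 ^ 0 + real m"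
      using binary_val_bounds[OF e] 
      by (intro add_mono Z_poly_coeff_limit(2)[OF assms(1)]) (simp add: norm_mult mult_left_le)
    finally show "norm (?D e) \<le> 4 * real m * 4 ^ 0 + real m" .
  qed
  then show ?thesis by simp
qed

text \<open>Let y' be the value of the shifted sequence. As the constant coefficient there is m y',
  the inhomogeneous term is i m y' or i m (1 - y'), which \<open>dist_int_binary_val\<close>
  identifies as 2 m i times \<open>dist_int (binary_val d)\<close>. This is the Takagi recursion
  scaled by 2 m i.\<close>

lemma Z_lim_nth_1:
  assumes "m \<ge> 1" "binary_seq d"
  shows "fps_nth (Z_lim m d 1) 1 = 2 * of_nat m * \<i> * of_real (takagi (binary_val d))"
proof -
  let ?D = "\<lambda>d. fps_nth (Z_lim m d 1) 1 - 2 * of_nat m * \<i> * of_real (takagi (binary_val d))"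
  have "?D d = 0"
  proof (rule halving_bounded_eq_0[OF _ _ assms(2), of ?D])
    fix e assume e: "binary_seq e"
    show "?D e = ?D (shift e) / 2"
      unfolding Z_lim_nth_1_shift[OF assms(1), of e] Z_lim_nth_0[OF assms(1) binary_seq_shift[OF e]]
        takagi_binary_val[OF e] dist_int_binary_val[OF e]
      by (cases "e 0 = 0") (simp_all add: field_simps)
    have "norm (?D e) \<le> norm (fps_nth (Z_lim m e 1) 1)
        + norm (2 * of_nat m * \<i> * of_real (takagi (binary_val e)) :: complex)"
      by (rule norm_triangle_ineq4)
    also have "\<dots> \<le> 4 * real m * 4 ^ 1 + 2 * real m * 2"
      using takagi_bound[of "binary_val e"]
      by (intro add_mono Z_poly_coeff_limit(2)[OF assms(1)])
        (simp add: norm_mult mult_left_mono mult.commute[of 2])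
    finally show "norm (?D e) \<le> 4 * real m * 4 ^ 1 + 2 * real m * 2" .
  qed
  then show ?thesis by simp
qed

section \<open>Convergence and differentiation at 0\<close>

lemma fps_conv_radius_Z_lim_pos:
  assumes "m \<ge> 1"
  shows "fps_conv_radius (Z_lim m d 1) > 0"
proof -
  \<comment> \<open>Coefficients grow at most like \<open>4 ^ k\<close>, so the test point 1/8
    leaves a geometric series of ratio 1/2. Differentiating at 0 only requires some positive
    radius.\<close>
  have "summable (\<lambda>k. fps_nth (Z_lim m d 1) k * of_real (1 / 8) ^ k)"
  proof (rule summable_comparison_test')
    show "summable (\<lambda>k. 4 * real m * (1 / 2) ^ k)"
      by (intro summable_mult summable_geometric) simp
    fix k :: nat
    have "norm (fps_nth (Z_lim m d 1) k * of_real (1 / 8) ^ k)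
        \<le> 4 * real m * 4 ^ k * (1 / 8) ^ k"
      using Z_poly_coeff_limit(2)[OF assms, of d k]
      by (simp add: norm_mult norm_power norm_divide mult_right_mono divide_right_mono power_divide)
    also have "\<dots> = 4 * real m * (1 / 2) ^ k"
      using power_mult_distrib[of 4 "1 / 8 :: real" k] by simp
    finally show "norm (fps_nth (Z_lim m d 1) k * of_real (1 / 8) ^ k) \<le> 4 * real m * (1 / 2) ^ k" .
  qed
  then have "ereal (norm (of_real (1 / 8) :: complex)) \<le> fps_conv_radius (Z_lim m d 1)"
    unfolding fps_conv_radius_def by (rule conv_radius_geI)
  then show ?thesis
    by (rule less_le_trans[rotated]) simp
qed

theorem mainTheorem5:
  fixes m :: nat and x :: real
  assumes "m \<ge> 2" and "x \<in> {0..real m}"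
  shows "((\<lambda>\<beta>::real. eval_fps (Z_lim m (inv_into Omega (address_val m) x) 1) (complex_of_real \<beta>))
           has_vector_derivative (2 * of_nat m * \<i> * of_real (takagi (x / real m)))) (at 0)"
proof -
  let ?d = "inv_into Omega (address_val m) x"
  let ?Z = "Z_lim m ?d 1"
  have m: "m \<ge> 1" "m > 0" using assms(1) by auto
  have x: "x \<in> address_val m ` Omega"
    using address_val_surj[OF m(2) assms(2)] .
  have bin: "binary_seq ?d"
    using inv_into_into[OF x] by (rule Omega_binary_seq)
  have "real m * binary_val ?d = x"
    using f_inv_into_f[OF x] by (simp add: address_val_def binary_val_def)
  then have val: "binary_val ?d = x / real m"
    using m by (simp add: field_simps)
  have "(eval_fps ?Z has_field_derivative eval_fps (fps_deriv ?Z) 0) (at 0)"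
    using fps_conv_radius_Z_lim_pos[OF m(1), of ?d]
    by (intro has_field_derivative_eval_fps) (simp add: zero_ereal_def)
  \<comment> \<open>The constant term of the formal derivative is the coefficient of order 1.
    Writing the point as \<open>complex_of_real 0\<close> prepares the restriction to real
    parameters.\<close>
  then have "(eval_fps ?Z has_field_derivative fps_nth ?Z 1) (at (complex_of_real 0))"
    by (simp add: eval_fps_at_0)
  from has_vector_derivative_real_field[OF this]
  show ?thesis
    using Z_lim_nth_1[OF m(1) bin] val by simp
qed

end
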